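(* For all natural numbers $n$ and $k$ with $n \ge k$, $$\sum_{i=0}^{k} q^{i} \genfrac{[}{]}{0pt}{}{n-k-1+i}{i}_q = \genfrac{[}{]}{0pt}{}{n}{k}_q .$$
   Context: Natural numbers here are non-negative integers, and $q$ is an indeterminate. For a non-negative integer $k$, the Gaussian polynomial ($q$-binomial coefficient) is $$\genfrac{[}{]}{0pt}{}{n}{k}_q = \frac{(q^n-1)(q^{n-1}-1)\cdots(q^{n-k+1}-1)}{(q^k-1)(q^{k-1}-1)\cdots(q-1)},$$ with the empty product (case $k=0$) equal to $1$, so $\genfrac{[}{]}{0pt}{}{n}{0}_q=1$; the value is $0$ if $0\le n<k$. In the boundary case $n=k$, the term $i=0$ of the sum is $\genfrac{[}{]}{0pt}{}{-1}{0}_q$, which is interpreted as the empty product $1$. The identity is an identity of polynomials in $q$. *)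

theory Defs
  imports "HOL-Computational_Algebra.Polynomial"
begin

abbreviation q :: "int poly" where
  "q \<equiv> [:0, 1:]"

(* The upper argument is an integer because -1 occurs as the upper argument of
   q_binomial (-1) 0, which is then the empty product 1.  For 0 \<le> n < k the numerator
   contains the factor q ^ 0 - 1 = 0 (at j = n), so the value is 0.  The truncation by nat
   only affects exponents n - j < 0; the value for n < 0 < k is 0 and is not meaningful.
   The division is exact; see q_binomial_mult_denominator. *)
definition q_binomial :: "int \<Rightarrow> nat \<Rightarrow> int poly" where
  "q_binomial n k =
     (\<Prod>j<k. q ^ nat (n - int j) - 1) div (\<Prod>j<k. q ^ (k - j) - 1)"

lemma q_power_neq_one: "m > 0 \<Longrightarrow> q ^ m - 1 \<noteq> 0"
proof
  assume "m > 0" "q ^ m - 1 = 0"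
  then have "poly (q ^ m) 0 = poly 1 0" by simp
  with \<open>m > 0\<close> show False by (simp add: power_0_left)
qed

lemma q_binomial_denominator_nonzero: "(\<Prod>j<k. q ^ (k - j) - 1) \<noteq> 0"
proof -
  have "q ^ (k - j) - 1 \<noteq> 0" if "j < k" for j
    using q_power_neq_one[of "k - j"] that by simp
  then show ?thesis by (subst prod_zero_iff) auto
qed

lemma q_binomial_denominator_Suc:
  "(\<Prod>j<Suc k. q ^ (Suc k - j) - 1) = (q ^ Suc k - 1) * (\<Prod>j<k. q ^ (k - j) - 1)"
  by (subst prod.lessThan_Suc_shift) simp

lemma q_binomial_numerator_Suc_Suc:
  "(\<Prod>j<Suc k. q ^ nat (int (Suc n) - int j) - 1) =
     (q ^ Suc n - 1) * (\<Prod>j<k. q ^ nat (int n - int j) - 1)"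
proof -
  have "nat (1 + int n) = Suc n" by simp
  then show ?thesis by (subst prod.lessThan_Suc_shift) simp
qed

lemma q_binomial_numerator_eq_0:
  assumes "n < int k" "k > 0"
  shows "(\<Prod>j<k. q ^ nat (n - int j) - 1) = 0"
proof -
  have "q ^ nat (n - int (k - 1)) - 1 = 0" using assms by simp
  moreover have "k - 1 \<in> {..<k}" using assms by simp
  ultimately show ?thesis by (intro prod_zero) blast+
qed

lemma q_binomial_denominator_dvd_nat:
  "(\<Prod>j<k. q ^ (k - j) - 1) dvd (\<Prod>j<k. q ^ nat (int n - int j) - 1)"
proof (induction n arbitrary: k)
  case 0
  show ?case
    by (cases "k = 0") (simp_all add: power_0_left)
next
  case (Suc n)
  show ?case
  proof (cases k)
    case k: (Suc l)
    let ?num = "\<lambda>l. \<Prod>j<l. q ^ nat (int n - int j) - 1"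
    let ?den = "\<lambda>l. \<Prod>j<l. q ^ (l - j) - 1"
    have "(q ^ Suc n - 1) * ?num l = q ^ Suc l * ?num (Suc l) + (q ^ Suc l - 1) * ?num l"
    proof (cases "l \<le> n")
      case True
      have "q ^ Suc n = q ^ Suc l * q ^ nat (int n - int l)"
        using True by (simp only: power_add[symmetric]) (simp add: nat_diff_distrib)
      then have "q ^ Suc n - 1 =
          q ^ Suc l * (q ^ nat (int n - int l) - 1) + (q ^ Suc l - 1)"
        by (simp only: right_diff_distrib)
      moreover have "(a * b + c) * d = a * (d * b) + c * d" for a b c d :: "int poly"
        by (simp add: algebra_simps)
      ultimately show ?thesis
        by (simp only: prod.lessThan_Suc)
    next
      case False
      then have "?num l = 0" "?num (Suc l) = 0"
        by (intro q_binomial_numerator_eq_0; simp)+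
      then show ?thesis by (simp only: mult_zero_right)
    qed
    moreover have "?den (Suc l) dvd q ^ Suc l * ?num (Suc l)"
      by (rule dvd_mult, rule Suc.IH)
    moreover have "?den (Suc l) dvd (q ^ Suc l - 1) * ?num l"
      by (subst q_binomial_denominator_Suc, rule mult_dvd_mono[OF dvd_refl Suc.IH])
    ultimately show ?thesis
      unfolding k q_binomial_numerator_Suc_Suc by (simp only: dvd_add)
  qed simp
qed

lemma q_binomial_mult_denominator:
  "q_binomial n k * (\<Prod>j<k. q ^ (k - j) - 1) = (\<Prod>j<k. q ^ nat (n - int j) - 1)"
proof -
  have "(\<Prod>j<k. q ^ (k - j) - 1) dvd (\<Prod>j<k. q ^ nat (n - int j) - 1)"
  proof (cases "n \<ge> 0")
    case True
    then show ?thesis using q_binomial_denominator_dvd_nat[of k "nat n"] by simp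
  next
    case False
    then show ?thesis
      by (cases "k = 0") (simp_all add: power_0_left)
  qed
  then show ?thesis unfolding q_binomial_def by (rule dvd_div_mult_self)
qed

end

theory Submission
  imports Defs
begin

text \<open>
  Write \<open>m = n - k\<close> and let \<open>k\<close> grow with \<open>m\<close> fixed: the summand for \<open>i = k + 1\<close> is
  \<open>q\<^sup>k\<^sup>+\<^sup>1\<close> times the \<open>q\<close>-binomial coefficient of \<open>m + k\<close> over \<open>k + 1\<close>, which by the
  \<open>q\<close>-Pascal rule \<open>q_binomial_Suc_Suc\<close> is exactly the difference between the right-hand
  sides for \<open>k + 1\<close> and \<open>k\<close>. So the sum telescopes, starting from \<open>1 = 1\<close> at \<open>k = 0\<close>.
\<close>

lemma q_binomial_0_right [simp]: "q_binomial n 0 = 1"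
  by (simp add: q_binomial_def)

text \<open>
  The numerators of both coefficients on the right start with the same \<open>k\<close> factors. After
  clearing denominators the rule therefore reduces to splitting the remaining factor as
  \<open>q\<^sup>n\<^sup>+\<^sup>1 - 1 = (q\<^sup>k\<^sup>+\<^sup>1 - 1) + q\<^sup>k\<^sup>+\<^sup>1 (q\<^sup>n\<^sup>-\<^sup>k - 1)\<close>, which needs \<open>k \<le> n\<close>; for \<open>n < k\<close> all
  numerators vanish.
\<close>
lemma q_binomial_Suc_Suc:
  "q_binomial (int (Suc n)) (Suc k) =
     q_binomial (int n) k + q ^ Suc k * q_binomial (int n) (Suc k)"
proof -
  let ?num = "\<lambda>l. \<Prod>j<l. q ^ nat (int n - int j) - 1"
  let ?den = "\<lambda>l. \<Prod>j<l. q ^ (l - j) - 1"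
  have split_numerator:
    "(q ^ Suc n - 1) * ?num k = (q ^ Suc k - 1) * ?num k + q ^ Suc k * ?num (Suc k)"
  proof (cases "k \<le> n")
    case True
    then have "q ^ Suc n = q ^ Suc k * q ^ nat (int n - int k)"
      by (simp only: power_add[symmetric]) (simp add: nat_diff_distrib)
    moreover have "(a * b - 1) * d = (a - 1) * d + a * (d * (b - 1))" for a b d :: "int poly"
      by (simp add: algebra_simps)
    ultimately show ?thesis
      by (simp only: prod.lessThan_Suc)
  next
    case False
    then have "?num k = 0" "?num (Suc k) = 0"
      by (intro q_binomial_numerator_eq_0; simp)+
    then show ?thesis by (simp only: mult_zero_right add_0)
  qed
  have "q_binomial (int (Suc n)) (Suc k) * ?den (Suc k) = (q ^ Suc n - 1) * ?num k"
    by (simp only: q_binomial_mult_denominator q_binomial_numerator_Suc_Suc)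
  also have "\<dots> = (q ^ Suc k - 1) * (q_binomial (int n) k * ?den k)
      + q ^ Suc k * (q_binomial (int n) (Suc k) * ?den (Suc k))"
    by (simp only: split_numerator q_binomial_mult_denominator)
  also have "\<dots> =
      (q_binomial (int n) k + q ^ Suc k * q_binomial (int n) (Suc k)) * ?den (Suc k)"
    by (simp only: q_binomial_denominator_Suc distrib_left distrib_right mult_ac)
  finally show ?thesis
    by (rule mult_right_cancel[OF q_binomial_denominator_nonzero, THEN iffD1])
qed

text \<open>
  The offset \<open>m\<close> keeps the summands independent of the upper limit, as the induction on
  \<open>k\<close> requires.
\<close>
lemma sum_q_binomial_diagonal:
  "(\<Sum>i=0..k. q ^ i * q_binomial (int m - 1 + int i) i) = q_binomial (int (m + k)) k"
proof (induction k)
  case (Suc k)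
  have "int m - 1 + int (Suc k) = int (m + k)" by simp
  then show ?case
    by (simp only: sum.atLeast0_atMost_Suc Suc.IH add_Suc_right q_binomial_Suc_Suc)
qed simp

theorem theorem1:
  fixes n k :: nat
  assumes "n \<ge> k"
  shows "(\<Sum>i=0..k. q ^ i * q_binomial (int n - int k - 1 + int i) i) = q_binomial (int n) k"
  using sum_q_binomial_diagonal[where m = "n - k" and k = k] assms by (simp add: of_nat_diff)

end
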